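(* Let $H=(V,E)$ be a hypergraph with associated polymatroid $P_H$, and let $e\in E$. Then $$P_{H\setminus e}=P_H\setminus e\qquad\text{and}\qquad P_{H/e}\cong P_H/e,$$ where $\cong$ denotes isomorphism of polymatroids (a groundset bijection preserving the rank function), the left-hand operations are hypergraph deletion and contraction and the right-hand operations are polymatroid deletion and contraction.
   Context: A hypergraph is a pair $H=(V,E)$ where $V$ is a finite set and $E$ is a finite multiset (parallel hyperedges are allowed and treated as distinct elements of $E$) of multisets of elements of $V$, called hyperedges. Every hyperedge has size (counted with multiplicity) greater than $1$. Write $v(H)=|V|$. $\kappa(H)$ is the number of connected components of the bipartite incidence graph with vertex classes $V$ and $E$, in which $u\in V$ and $e\in E$ are joined by as many edges as the multiplicity of $u$ in $e$. For $A\subseteq E$ let $\kappa_H(A)=\kappa((V,A))$. Hypergraph deletion: $H\setminus e=(V,E\setminus\{e\})$. Hypergraph contraction: $H/e=(V',E')$ with $V'=(V\setminus e)\cup\{v_e\}$ (all vertices occurring in $e$ are removed and one new vertex $v_e$ is added) and $E'=\{f':f\in E\setminus\{e\}\}$, where $f'$ is obtained from $f$ by replacing every occurrence (with multiplicity) of a vertex of $e$ by $v_e$. A polymatroid is a pair $P=(E,r)$ with $E$ finite and $r:2^E\to\mathbb{Z}$ normalized ($r(\emptyset)=0$), increasing and submodular. Polymatroid deletion: $P\setminus e=(E\setminus\{e\},r|_{2^{E\setminus\{e\}}})$; contraction: $P/e=(E\setminus\{e\},r')$ with $r'(X)=r(X\cup\{e\})-r(\{e\})$. The associated polymatroid $P_H$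 of $H$ has groundset $E$ and rank function $r(A)=v(H)-\kappa_H(A)$ for $A\subseteq E$ (it is known that this is a polymatroid). *)

theory Defs
  imports "HOL-Library.Multiset" "HOL-Library.FuncSet"
begin

text \<open>Parallel hyperedges are distinct elements of the edge multiset, so hyperedges are given by
  labels: the edge multiset is the family of multisets \<open>ends H f\<close> indexed by \<open>f \<in> edges H\<close>.\<close>

record ('v, 'e) hypergraph =
  verts :: "'v set"
  edges :: "'e set"
  ends :: "'e \<Rightarrow> 'v multiset"

definition is_hypergraph :: "('v, 'e) hypergraph \<Rightarrow> bool" where
  "is_hypergraph H \<longleftrightarrow>
     finite (verts H) \<and> finite (edges H) \<and>
     (\<forall>f\<in>edges H. set_mset (ends H f) \<subseteq> verts H \<and> size (ends H f) > 1)"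

text \<open>The bipartite incidence multigraph; the third component of an edge \<open>(u, f, i)\<close> tells
  apart the parallel copies.\<close>

definition incidence_verts :: "('v, 'e) hypergraph \<Rightarrow> ('v + 'e) set" where
  "incidence_verts H = verts H <+> edges H"

definition incidence_edges :: "('v, 'e) hypergraph \<Rightarrow> ('v \<times> 'e \<times> nat) set" where
  "incidence_edges H =
     {(u, f, i). u \<in> verts H \<and> f \<in> edges H \<and> i < count (ends H f) u}"

definition incidence_adj :: "('v, 'e) hypergraph \<Rightarrow> ('v + 'e) rel" where
  "incidence_adj H =
     (\<Union>(u, f, i)\<in>incidence_edges H. {(Inl u, Inr f), (Inr f, Inl u)})"

definition incidence_connected :: "('v, 'e) hypergraph \<Rightarrow> ('v + 'e) rel" where
  "incidence_connected H =
     {(x, y). x \<in> incidence_verts H \<and> y \<in> incidence_verts H \<and> (x, y) \<in> (incidence_adj H)\<^sup>*}"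

definition num_components :: "('v, 'e) hypergraph \<Rightarrow> nat" where
  "num_components H = card (incidence_verts H // incidence_connected H)"

definition num_components_on :: "('v, 'e) hypergraph \<Rightarrow> 'e set \<Rightarrow> nat" where
  "num_components_on H A = num_components (H\<lparr>edges := A\<rparr>)"

definition hdelete :: "('v, 'e) hypergraph \<Rightarrow> 'e \<Rightarrow> ('v, 'e) hypergraph" where
  "hdelete H e = H\<lparr>edges := edges H - {e}\<rparr>"

text \<open>In a contraction the old vertices \<open>u\<close> become \<open>Some u\<close>, and \<open>None\<close> is the new vertex;
  each hyperedge keeps its label.\<close>

definition hcontract :: "('v, 'e) hypergraph \<Rightarrow> 'e \<Rightarrow> ('v option, 'e) hypergraph" where
  "hcontract H e =
     \<lparr>verts = Some ` (verts H - set_mset (ends H e)) \<union> {None},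
      edges = edges H - {e},
      ends = (\<lambda>f. image_mset (\<lambda>u. if u \<in># ends H e then None else Some u) (ends H f))\<rparr>"

text \<open>Rank functions are kept extensional, that is, \<open>undefined\<close> outside the power set of the
  groundset, so that equality of polymatroids is equality of records.\<close>

record 'e polymatroid =
  ground :: "'e set"
  rank :: "'e set \<Rightarrow> int"

definition is_polymatroid :: "'e polymatroid \<Rightarrow> bool" where
  "is_polymatroid P \<longleftrightarrow>
     finite (ground P) \<and> rank P \<in> extensional (Pow (ground P)) \<and>
     rank P {} = 0 \<and>
     (\<forall>A B. A \<subseteq> B \<longrightarrow> B \<subseteq> ground P \<longrightarrow> rank P A \<le> rank P B) \<and>
     (\<forall>A B. A \<subseteq> ground P \<longrightarrow> B \<subseteq> ground P \<longrightarrow>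
        rank P (A \<union> B) + rank P (A \<inter> B) \<le> rank P A + rank P B)"

definition pdelete :: "'e polymatroid \<Rightarrow> 'e \<Rightarrow> 'e polymatroid" where
  "pdelete P e =
     \<lparr>ground = ground P - {e}, rank = restrict (rank P) (Pow (ground P - {e}))\<rparr>"

definition pcontract :: "'e polymatroid \<Rightarrow> 'e \<Rightarrow> 'e polymatroid" where
  "pcontract P e =
     \<lparr>ground = ground P - {e},
      rank = (\<lambda>X\<in>Pow (ground P - {e}). rank P (X \<union> {e}) - rank P {e})\<rparr>"

definition polymatroid_iso :: "'e polymatroid \<Rightarrow> 'f polymatroid \<Rightarrow> bool" (infix "\<cong>\<^sub>P" 50) where
  "P \<cong>\<^sub>P Q \<longleftrightarrow>
     (\<exists>\<phi>. bij_betw \<phi> (ground P) (ground Q) \<and>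
          (\<forall>A\<subseteq>ground P. rank Q (\<phi> ` A) = rank P A))"

definition assoc_polymatroid :: "('v, 'e) hypergraph \<Rightarrow> 'e polymatroid" where
  "assoc_polymatroid H =
     \<lparr>ground = edges H,
      rank = (\<lambda>A\<in>Pow (edges H). int (card (verts H)) - int (num_components_on H A))\<rparr>"

lemma is_hypergraph_hdelete: "is_hypergraph H \<Longrightarrow> is_hypergraph (hdelete H e)"
  by (auto simp: is_hypergraph_def hdelete_def)

lemma is_hypergraph_hcontract:
  "is_hypergraph H \<Longrightarrow> is_hypergraph (hcontract H e)"
  by (auto simp: is_hypergraph_def hcontract_def)

lemma is_polymatroid_pdelete: "is_polymatroid P \<Longrightarrow> is_polymatroid (pdelete P e)"
  by (auto simp: is_polymatroid_def pdelete_def le_infI1 subset_Diff_insert)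

lemma is_polymatroid_pcontract:
  assumes P: "is_polymatroid P" and e: "e \<in> ground P"
  shows "is_polymatroid (pcontract P e)"
proof -
  let ?G = "ground P - {e}"
  have sub: "rank P (A \<union> B) + rank P (A \<inter> B) \<le> rank P A + rank P B"
    if "A \<subseteq> ground P" "B \<subseteq> ground P" for A B
    using P that by (simp add: is_polymatroid_def)
  have mon: "rank P A \<le> rank P B" if "A \<subseteq> B" "B \<subseteq> ground P" for A B
    using P that by (simp add: is_polymatroid_def)
  have m: "rank P (insert e A) \<le> rank P (insert e B)" if "A \<subseteq> B" "B \<subseteq> ?G" for A B
    using that e by (intro mon) auto
  have s: "rank P (insert e (A \<union> B)) + rank P (insert e (A \<inter> B))
             \<le> rank P (insert e A) + rank P (insert e B)" if "A \<subseteq> ?G" "B \<subseteq> ?G" for A B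
    using sub[of "insert e A" "insert e B"] that e by (simp add: subset_Diff_insert)
  show ?thesis
    using P m s unfolding is_polymatroid_def pcontract_def
    by (auto simp: le_infI1 subset_Diff_insert)
qed


text \<open>The associated polymatroid is a polymatroid: the rank of \<open>A\<close> only depends on the
  partition of the vertices into the classes joined by hyperedges of \<open>A\<close>.\<close>

definition joined :: "('v, 'e) hypergraph \<Rightarrow> 'e set \<Rightarrow> 'v rel" where
  "joined H A = (\<Union>f\<in>A. set_mset (ends H f) \<times> set_mset (ends H f))"

definition joined_eq :: "('v, 'e) hypergraph \<Rightarrow> 'e set \<Rightarrow> 'v rel" where
  "joined_eq H A = {(u, v). u \<in> verts H \<and> v \<in> verts H \<and> (u, v) \<in> (joined H A)\<^sup>*}"

lemma incidence_adj_iff: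
  "(x, y) \<in> incidence_adj H \<longleftrightarrow>
     (\<exists>u f. u \<in> verts H \<and> f \<in> edges H \<and> u \<in># ends H f \<and>
        (x = Inl u \<and> y = Inr f \<or> x = Inr f \<and> y = Inl u))"
proof -
  have "(\<exists>i. i < count M u) \<longleftrightarrow> u \<in># M" for M :: "'a multiset" and u
    by (metis count_greater_zero_iff gr_zeroI not_less_zero)
  then show ?thesis
    unfolding incidence_adj_def incidence_edges_def by auto
qed

lemma sym_incidence_adj: "sym (incidence_adj H)"
  by (auto simp: incidence_adj_def sym_def)

lemma equiv_incidence_connected: "equiv (incidence_verts H) (incidence_connected H)"
proof (rule equivI)
  show "incidence_connected H \<subseteq> incidence_verts H \<times> incidence_verts H"
    by (auto simp: incidence_connected_def)
  show "refl_on (incidence_verts H) (incidence_connected H)"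
    by (auto simp: refl_on_def incidence_connected_def)
  show "sym (incidence_connected H)"
    using sym_rtrancl[OF sym_incidence_adj, of H]
    by (auto simp: sym_def incidence_connected_def)
  show "trans (incidence_connected H)"
    by (auto simp: trans_def incidence_connected_def)
qed

lemma equiv_joined_eq: "equiv (verts H) (joined_eq H A)"
proof (rule equivI)
  have "sym (joined H A)" by (auto simp: joined_def sym_def)
  from sym_rtrancl[OF this] show "sym (joined_eq H A)"
    by (auto simp: sym_def joined_eq_def)
  show "joined_eq H A \<subseteq> verts H \<times> verts H" "refl_on (verts H) (joined_eq H A)"
    by (auto simp: refl_on_def joined_eq_def)
  show "trans (joined_eq H A)"
    by (auto simp: trans_def joined_eq_def)
qed

lemma incidence_adj_rtrancl_iff:
  assumes H: "is_hypergraph H" and A: "A \<subseteq> edges H"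
  shows "(Inl u, Inl v) \<in> (incidence_adj (H\<lparr>edges := A\<rparr>))\<^sup>* \<longleftrightarrow> (u, v) \<in> (joined H A)\<^sup>*"
proof
  let ?R = "incidence_adj (H\<lparr>edges := A\<rparr>)"
  assume "(Inl u, Inl v) \<in> ?R\<^sup>*"
  moreover have "case y of Inl v \<Rightarrow> (u, v) \<in> (joined H A)\<^sup>*
      | Inr f \<Rightarrow> \<exists>w. w \<in># ends H f \<and> (u, w) \<in> (joined H A)\<^sup>*" if "(Inl u, y) \<in> ?R\<^sup>*" for y
    using that
  proof (induction rule: rtrancl_induct)
    case base
    then show ?case by simp
  next
    case (step y z)
    from step.hyps(2) obtain w f where wf: "f \<in> A" "w \<in># ends H f"
      and "y = Inl w \<and> z = Inr f \<or> y = Inr f \<and> z = Inl w" unfolding incidence_adj_iff by auto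
    then show ?case
    proof (elim disjE conjE)
      assume "y = Inl w" "z = Inr f"
      then show ?thesis using step.IH wf by auto
    next
      assume yz: "y = Inr f" "z = Inl w"
      with step.IH obtain x where x: "x \<in># ends H f" "(u, x) \<in> (joined H A)\<^sup>*" by auto
      with wf have "(x, w) \<in> joined H A" by (auto simp: joined_def)
      with x yz show ?thesis by (auto intro: rtrancl_into_rtrancl)
    qed
  qed
  ultimately show "(u, v) \<in> (joined H A)\<^sup>*" by fastforce
next
  let ?R = "incidence_adj (H\<lparr>edges := A\<rparr>)"
  assume "(u, v) \<in> (joined H A)\<^sup>*"
  then show "(Inl u, Inl v) \<in> ?R\<^sup>*"
  proof (induction rule: rtrancl_induct)
    case base
    then show ?case by simp
  next
    case (step x y)
    then obtain f where f: "f \<in> A" "x \<in># ends H f" "y \<in># ends H f"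
      by (auto simp: joined_def)
    then have "x \<in> verts H" "y \<in> verts H" using H A by (auto simp: is_hypergraph_def)
    with f have "(Inl x, Inr f) \<in> ?R" "(Inr f, Inl y) \<in> ?R"
      by (auto simp: incidence_adj_iff)
    with step.IH show ?case by (meson rtrancl.rtrancl_into_rtrancl)
  qed
qed

lemma num_components_on_eq:
  assumes H: "is_hypergraph H" and A: "A \<subseteq> edges H"
  shows "num_components_on H A = card (verts H // joined_eq H A)"
proof -
  let ?G = "H\<lparr>edges := A\<rparr>"
  let ?C = "incidence_connected ?G"
  have iff: "(Inl u, Inl v) \<in> ?C \<longleftrightarrow> (u, v) \<in> joined_eq H A" for u v
    using incidence_adj_rtrancl_iff[OF H A]
    by (auto simp: incidence_connected_def incidence_verts_def joined_eq_def)
  have vi: "Inl -` (?C `` {Inl u}) = joined_eq H A `` {u}" for u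
    using iff by auto
  have cls: "\<exists>u\<in>verts H. K = ?C `` {Inl u}" if K: "K \<in> incidence_verts ?G // ?C" for K
  proof -
    obtain x where x: "x \<in> incidence_verts ?G" "K = ?C `` {x}"
      using K by (auto elim: quotientE)
    show ?thesis
    proof (cases x)
      case (Inl u)
      then show ?thesis using x by (auto simp: incidence_verts_def)
    next
      case (Inr f)
      with x have f: "f \<in> A" by (auto simp: incidence_verts_def)
      with H A have "ends H f \<noteq> {#}" by (force simp: is_hypergraph_def)
      then obtain u where u: "u \<in># ends H f" by auto
      with H A f have "u \<in> verts H" by (auto simp: is_hypergraph_def)
      with u f have "(Inl u, Inr f) \<in> incidence_adj ?G"
        by (auto simp: incidence_adj_iff)
      with \<open>u \<in> verts H\<close> f have "(Inl u, Inr f) \<in> ?C"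
        by (auto simp: incidence_connected_def incidence_verts_def)
      then have "K = ?C `` {Inl u}"
        using x Inr equiv_class_eq[OF equiv_incidence_connected] by metis
      with \<open>u \<in> verts H\<close> show ?thesis by blast
    qed
  qed
  have "bij_betw (\<lambda>K. Inl -` K) (incidence_verts ?G // ?C) (verts H // joined_eq H A)"
  proof (rule bij_betwI')
    fix K L assume KL: "K \<in> incidence_verts ?G // ?C" "L \<in> incidence_verts ?G // ?C"
    then obtain u v where u: "u \<in> verts H" "K = ?C `` {Inl u}" and v: "v \<in> verts H" "L = ?C `` {Inl v}"
      using cls by meson
    have "K = L" if "Inl -` K = (Inl -` L :: 'a set)"
    proof -
      have "joined_eq H A `` {u} = joined_eq H A `` {v}" using that u v vi by metis
      then have "(u, v) \<in> joined_eq H A"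
        using u v eq_equiv_class[OF _ equiv_joined_eq] by metis
      then have "(Inl u, Inl v) \<in> ?C" by (simp add: iff)
      then show ?thesis using u v equiv_class_eq[OF equiv_incidence_connected] by metis
    qed
    then show "(Inl -` K = (Inl -` L :: 'a set)) = (K = L)" by blast
  next
    fix K assume "K \<in> incidence_verts ?G // ?C"
    then obtain u where "u \<in> verts H" "K = ?C `` {Inl u}" using cls by meson
    then show "Inl -` K \<in> verts H // joined_eq H A" using vi by (metis quotientI)
  next
    fix M assume "M \<in> verts H // joined_eq H A"
    then obtain u where u: "u \<in> verts H" "M = joined_eq H A `` {u}" by (auto elim: quotientE)
    then have "?C `` {Inl u} \<in> incidence_verts ?G // ?C"
      by (auto simp: incidence_verts_def intro: quotientI)
    with u vi show "\<exists>K\<in>incidence_verts ?G // ?C. M = Inl -` K" by blast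
  qed
  then show ?thesis
    by (simp add: num_components_on_def num_components_def bij_betw_same_card)
qed

lemma joined_eq_insert:
  assumes H: "is_hypergraph H" and f: "f \<in> edges H"
  defines "T \<equiv> set_mset (ends H f)"
  shows "joined_eq H (insert f A) = joined_eq H A \<union> (joined_eq H A `` T) \<times> (joined_eq H A `` T)"
    (is "?L = ?R")
proof
  have T: "T \<subseteq> verts H" using H f by (auto simp: is_hypergraph_def T_def)
  note eqv = equiv_joined_eq[of H A]
  have ins: "joined H (insert f A) = joined H A \<union> T \<times> T"
    by (auto simp: joined_def T_def)
  have sy: "(v, u) \<in> (joined H A)\<^sup>*" if "(u, v) \<in> (joined H A)\<^sup>*" for u v
    using that sym_rtrancl[of "joined H A"] by (auto simp: joined_def sym_def)
  have "(u, v) \<in> (joined H A)\<^sup>* \<or> (\<exists>s\<in>T. \<exists>t\<in>T. (s, u) \<in> (joined H A)\<^sup>* \<and> (t, v) \<in> (joined H A)\<^sup>*)"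
    if "(u, v) \<in> (joined H (insert f A))\<^sup>*" for u v
    using that
  proof (induction rule: rtrancl_induct)
    case base
    then show ?case by simp
  next
    case (step x y)
    from step.hyps(2) consider "(x, y) \<in> joined H A" | "x \<in> T" "y \<in> T"
      unfolding ins by blast
    then show ?case
    proof cases
      case 1
      with step.IH show ?thesis by (meson rtrancl.rtrancl_into_rtrancl)
    next
      case 2
      with step.IH sy[of u x] show ?thesis by blast
    qed
  qed
  then show "?L \<subseteq> ?R" using T unfolding joined_eq_def by blast
  have m: "(u, v) \<in> (joined H (insert f A))\<^sup>*" if "(u, v) \<in> (joined H A)\<^sup>*" for u v
    using that rtrancl_mono[of "joined H A" "joined H (insert f A)"] ins by blast
  have "(u, v) \<in> (joined H (insert f A))\<^sup>*"
    if "s \<in> T" "t \<in> T" "(s, u) \<in> (joined H A)\<^sup>*" "(t, v) \<in> (joined H A)\<^sup>*" for s t u v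
  proof -
    have "(s, t) \<in> joined H (insert f A)" using that ins by blast
    then show ?thesis using m[OF sy[OF that(3)]] m[OF that(4)]
      by (meson rtrancl.rtrancl_into_rtrancl rtrancl_trans)
  qed
  then show "?R \<subseteq> ?L" using m unfolding joined_eq_def by blast
qed

lemma num_components_on_insert:
  assumes H: "is_hypergraph H" and A: "A \<subseteq> edges H" and f: "f \<in> edges H"
  shows "num_components_on H (insert f A) + card (set_mset (ends H f) // joined_eq H A)
           = num_components_on H A + 1"
proof -
  let ?V = "verts H" and ?T = "set_mset (ends H f)"
  let ?R = "joined_eq H A" and ?R' = "joined_eq H (insert f A)"
  note eqv = equiv_joined_eq[of H A]
  have T: "?T \<subseteq> ?V" and fin: "finite ?V" using H f by (auto simp: is_hypergraph_def)
  have "ends H f \<noteq> {#}" using H f by (force simp: is_hypergraph_def)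
  then have ne: "?T \<noteq> {}" by simp
  note R' = joined_eq_insert[OF H f, of A]
  have in_cl: "?R' `` {u} = ?R `` ?T" if "u \<in> ?R `` ?T" for u
    using that eqv unfolding R' equiv_def trans_def by blast
  have out_cl: "?R' `` {u} = ?R `` {u}" if "u \<notin> ?R `` ?T" for u
    using that unfolding R' by blast
  have touch: "?R `` {u} \<in> ?T // ?R \<longleftrightarrow> u \<in> ?R `` ?T" if "u \<in> ?V" for u
  proof
    assume "?R `` {u} \<in> ?T // ?R"
    then obtain t where "t \<in> ?T" "?R `` {u} = ?R `` {t}" by (auto elim: quotientE)
    then show "u \<in> ?R `` ?T" using that eqv by (metis Image_iff Image_singleton_iff equiv_class_self)
  next
    assume "u \<in> ?R `` ?T"
    then obtain t where "t \<in> ?T" "(t, u) \<in> ?R" by blast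
    then show "?R `` {u} \<in> ?T // ?R" using equiv_class_eq[OF eqv] by (metis quotientI)
  qed
  have TR: "?T // ?R \<subseteq> ?V // ?R" using T by (auto simp: quotient_def)
  have TsubRT: "?T \<subseteq> ?R `` ?T" using T eqv unfolding equiv_def refl_on_def by blast
  have q: "?V // ?R' = insert (?R `` ?T) (?V // ?R - ?T // ?R)"
  proof (intro equalityI subsetI)
    fix K assume "K \<in> ?V // ?R'"
    then obtain u where "u \<in> ?V" "K = ?R' `` {u}" by (auto elim: quotientE)
    then show "K \<in> insert (?R `` ?T) (?V // ?R - ?T // ?R)"
      using in_cl out_cl touch by (metis DiffI insert_iff quotientI)
  next
    fix K assume "K \<in> insert (?R `` ?T) (?V // ?R - ?T // ?R)"
    then consider "K = ?R `` ?T" | "K \<in> ?V // ?R" "K \<notin> ?T // ?R" by blast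
    then show "K \<in> ?V // ?R'"
    proof cases
      case 1
      obtain t where "t \<in> ?T" using ne by blast
      then show ?thesis using 1 in_cl T TsubRT by (metis quotientI subsetD)
    next
      case 2
      then obtain u where "u \<in> ?V" "K = ?R `` {u}" by (auto elim: quotientE)
      then show ?thesis using 2 touch out_cl by (metis quotientI)
    qed
  qed
  have finq: "finite (?V // ?R)" using fin by (simp add: quotient_def)
  have "?R `` ?T \<notin> ?V // ?R - ?T // ?R"
  proof
    assume a: "?R `` ?T \<in> ?V // ?R - ?T // ?R"
    then obtain u where u: "u \<in> ?V" "?R `` ?T = ?R `` {u}" by (auto elim: quotientE)
    then have "u \<in> ?R `` ?T" using equiv_class_self[OF eqv] by metis
    with touch u a show False by auto
  qed
  then have "card (?V // ?R') + card (?T // ?R) = card (?V // ?R) + 1"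
    using finq TR card_mono[OF finq TR]
    by (simp add: q card_Diff_subset finite_subset)
  then show ?thesis
    using A f by (simp add: num_components_on_eq[OF H])
qed

lemma card_quotient_joined_antimono:
  assumes H: "is_hypergraph H" and f: "f \<in> edges H" and AB: "A \<subseteq> B"
  shows "card (set_mset (ends H f) // joined_eq H B) \<le> card (set_mset (ends H f) // joined_eq H A)"
proof -
  let ?T = "set_mset (ends H f)"
  have T: "?T \<subseteq> verts H" using H f by (auto simp: is_hypergraph_def)
  have "joined H A \<subseteq> joined H B" using AB by (auto simp: joined_def)
  then have sub: "joined_eq H A \<subseteq> joined_eq H B"
    using rtrancl_mono[of "joined H A" "joined H B"] unfolding joined_eq_def by blast
  have "joined_eq H B `` {t} = joined_eq H B `` (joined_eq H A `` {t})" if "t \<in> ?T" for t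
  proof -
    have "t \<in> joined_eq H A `` {t}"
      using that T equiv_class_self[OF equiv_joined_eq] by (metis subsetD)
    moreover have "trans (joined_eq H B)" using equiv_joined_eq[of H B] by (simp add: equiv_def)
    ultimately show ?thesis using sub by (blast dest: transD)
  qed
  then have "?T // joined_eq H B \<subseteq> (\<lambda>K. joined_eq H B `` K) ` (?T // joined_eq H A)"
    by (auto simp: quotient_def)
  moreover have "finite (?T // joined_eq H A)" by (simp add: quotient_def)
  ultimately show ?thesis using surj_card_le by blast
qed

lemma is_polymatroid_assoc_polymatroid:
  assumes H: "is_hypergraph H"
  shows "is_polymatroid (assoc_polymatroid H)"
proof -
  let ?E = "edges H"
  define r where "r A = int (card (verts H)) - int (num_components_on H A)" for A
  define t where "t A f = card (set_mset (ends H f) // joined_eq H A)" for A f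
  have finE: "finite ?E" using H by (simp add: is_hypergraph_def)
  have ins: "r (insert f A) = r A + int (t A f) - 1" if "A \<subseteq> ?E" "f \<in> ?E" for A f
    using num_components_on_insert[OF H that] unfolding r_def t_def by linarith
  have t1: "t A f \<ge> 1" if "f \<in> ?E" for A f
  proof -
    have "ends H f \<noteq> {#}" using H that by (force simp: is_hypergraph_def)
    then have "set_mset (ends H f) // joined_eq H A \<noteq> {}" by simp
    moreover have "finite (set_mset (ends H f) // joined_eq H A)" by (simp add: quotient_def)
    ultimately show ?thesis unfolding t_def by (simp add: Suc_le_eq card_gt_0_iff)
  qed
  have anti: "t B f \<le> t A f" if "f \<in> ?E" "A \<subseteq> B" for A B f
    unfolding t_def using card_quotient_joined_antimono[OF H that] .
  have mono: "r A \<le> r B" if "A \<subseteq> B" "B \<subseteq> ?E" for A B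
  proof -
    have "finite (B - A)" using finE that by (meson finite_Diff finite_subset)
    then have "X \<subseteq> ?E \<Longrightarrow> r A \<le> r (A \<union> X)" if "X \<subseteq> B - A" for X
      using finite_subset[OF that]
    proof (induction X rule: infinite_finite_induct)
      case (insert f X)
      then show ?case using ins[of "A \<union> X" f] t1[of f "A \<union> X"] \<open>A \<subseteq> B\<close> \<open>B \<subseteq> ?E\<close> by force
    qed auto
    from this[of "B - A"] show ?thesis using that by (metis Diff_partition Diff_subset order.trans subset_refl)
  qed
  have diff: "r (B \<union> X) - r B \<le> r (A \<union> X) - r A"
    if "finite X" "A \<subseteq> B" "B \<subseteq> ?E" "X \<subseteq> ?E" "X \<inter> B = {}" for A B X
    using that
  proof (induction X rule: finite_induct)
    case (insert f X)
    have "r (insert f (B \<union> X)) = r (B \<union> X) + int (t (B \<union> X) f) - 1"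
      "r (insert f (A \<union> X)) = r (A \<union> X) + int (t (A \<union> X) f) - 1"
      using insert.prems by (auto intro!: ins)
    moreover have "t (B \<union> X) f \<le> t (A \<union> X) f" using insert.prems by (intro anti) auto
    moreover have "r (B \<union> X) - r B \<le> r (A \<union> X) - r A" using insert by auto
    ultimately show ?case by simp
  qed simp
  have sub: "r (A \<union> B) + r (A \<inter> B) \<le> r A + r B" if "A \<subseteq> ?E" "B \<subseteq> ?E" for A B
  proof -
    have "finite (A - B)" using finE that by (meson finite_Diff finite_subset)
    then have "r (B \<union> (A - B)) - r B \<le> r ((A \<inter> B) \<union> (A - B)) - r (A \<inter> B)"
      using that by (intro diff) auto
    moreover have "B \<union> (A - B) = A \<union> B" "(A \<inter> B) \<union> (A - B) = A" by auto
    ultimately show ?thesis by simp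
  qed
  have "joined_eq H {} = Id_on (verts H)" by (auto simp: joined_eq_def joined_def)
  moreover have "verts H // Id_on (verts H) = (\<lambda>v. {v}) ` verts H"
    by (auto simp: quotient_def)
  ultimately have "r {} = 0"
    by (simp add: r_def num_components_on_eq[OF H] card_image)
  with mono sub finE show ?thesis
    unfolding is_polymatroid_def assoc_polymatroid_def r_def[symmetric]
    by (auto simp: le_infI1)
qed

end

theory Submission
  imports Defs
begin

text \<open>Contracting \<open>e\<close> applies to the vertices the projection that collapses the vertices of \<open>e\<close> to
  one point. Two vertices of \<open>H\<close> are joined by hyperedges in \<open>X \<union> {e}\<close> iff their projections are
  joined in \<open>H/e\<close> by hyperedges in \<open>X\<close>, so both sides have the same number of components. Moreover
  \<open>v(H) - v(H/e) = |e| - 1 = r({e})\<close>, where \<open>|e|\<close> counts distinct vertices, so the ranks agree and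
  the identity map of the groundset is an isomorphism.\<close>

lemma card_quotient_pullback:
  assumes r: "equiv A r" and s: "equiv B s" and g: "g ` A = B"
    and rs: "\<And>x y. x \<in> A \<Longrightarrow> y \<in> A \<Longrightarrow> (x, y) \<in> r \<longleftrightarrow> (g x, g y) \<in> s"
  shows "card (A // r) = card (B // s)"
proof -
  have pre: "g -` (s `` {g x}) \<inter> A = r `` {x}" if "x \<in> A" for x
    using that rs equiv_type[OF r] by blast
  have "inj_on (\<lambda>K. g -` K \<inter> A) (B // s)"
  proof (rule inj_on_inverseI)
    fix K assume "K \<in> B // s"
    then have "K \<subseteq> g ` A" using equiv_type[OF s] g by (auto simp: quotient_def)
    then show "g ` (g -` K \<inter> A) = K" by blast
  qed
  moreover have "(\<lambda>K. g -` K \<inter> A) ` (B // s) = A // r"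
    using pre by (auto simp: quotient_def simp flip: g)
  ultimately show ?thesis using card_image by metis
qed

definition contract_vertex :: "('v, 'e) hypergraph \<Rightarrow> 'e \<Rightarrow> 'v \<Rightarrow> 'v option" where
  "contract_vertex H e u = (if u \<in># ends H e then None else Some u)"

lemma contract_vertex_eq_iff:
  "contract_vertex H e u = contract_vertex H e v \<longleftrightarrow> u = v \<or> u \<in># ends H e \<and> v \<in># ends H e"
  by (auto simp: contract_vertex_def)

lemma edges_hcontract: "edges (hcontract H e) = edges H - {e}"
  by (simp add: hcontract_def)

lemma ends_hcontract: "ends (hcontract H e) f = image_mset (contract_vertex H e) (ends H f)"
  by (simp add: hcontract_def contract_vertex_def[abs_def])

lemma ends_edge:
  assumes "is_hypergraph H" and "e \<in> edges H"
  shows "set_mset (ends H e) \<subseteq> verts H" and "ends H e \<noteq> {#}"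
  using assms by (force simp: is_hypergraph_def)+

lemma verts_hcontract:
  assumes "is_hypergraph H" and "e \<in> edges H"
  shows "verts (hcontract H e) = contract_vertex H e ` verts H"
proof -
  \<comment> \<open>A hyperedge is nonempty, which is what puts \<open>None\<close> into the
    image.\<close>
  obtain t where "t \<in># ends H e" "t \<in> verts H" using ends_edge[OF assms] by blast
  then show ?thesis by (force simp: hcontract_def contract_vertex_def)
qed

lemma card_verts_hcontract:
  assumes "is_hypergraph H" and "e \<in> edges H"
  shows "card (verts (hcontract H e)) + card (set_mset (ends H e)) = card (verts H) + 1"
proof -
  have fin: "finite (verts H)" using assms by (simp add: is_hypergraph_def)
  have "card (verts (hcontract H e)) = card (verts H - set_mset (ends H e)) + 1"
    using fin by (simp add: hcontract_def card_image)
  then show ?thesis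
    using ends_edge(1)[OF assms] fin by (simp add: card_Diff_subset card_mono)
qed

text \<open>A path in the contraction lifts step by step. Where consecutive lifted steps do not fit
  together, the two preimages are vertices of \<open>e\<close> and \<open>e\<close> itself joins
  them.\<close>

lemma joined_rtrancl_hcontract_iff:
  "(contract_vertex H e u, contract_vertex H e v) \<in> (joined (hcontract H e) X)\<^sup>*
     \<longleftrightarrow> (u, v) \<in> (joined H (insert e X))\<^sup>*"
proof
  let ?c = "contract_vertex H e" and ?J = "joined H (insert e X)"
  assume "(?c u, ?c v) \<in> (joined (hcontract H e) X)\<^sup>*"
  moreover have same: "(a, b) \<in> ?J\<^sup>*" if "?c a = ?c b" for a b
    using that by (auto simp: contract_vertex_eq_iff joined_def)
  \<comment> \<open>The claim covers every preimage of \<open>z\<close>, since the next step may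
    leave from another preimage than the one reached.\<close>
  have "\<forall>w. ?c w = z \<longrightarrow> (u, w) \<in> ?J\<^sup>*" if "(?c u, z) \<in> (joined (hcontract H e) X)\<^sup>*" for z
    using that
  proof (induction rule: rtrancl_induct)
    case base
    then show ?case using same by metis
  next
    case (step y z)
    from step.hyps(2) obtain a b where ab: "y = ?c a" "z = ?c b" "(a, b) \<in> ?J"
      by (auto simp: joined_def ends_hcontract)
    with step.IH have "(u, b) \<in> ?J\<^sup>*" by (blast intro: rtrancl_into_rtrancl)
    then show ?case using same ab(2) by (metis rtrancl_trans)
  qed
  ultimately show "(u, v) \<in> ?J\<^sup>*" by blast
next
  let ?c = "contract_vertex H e"
  assume "(u, v) \<in> (joined H (insert e X))\<^sup>*"
  then show "(?c u, ?c v) \<in> (joined (hcontract H e) X)\<^sup>*"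
  proof (induction rule: rtrancl_induct)
    case (step y z)
    \<comment> \<open>A step through \<open>e\<close> collapses to a point; a step through a
      hyperedge in \<open>X\<close> survives.\<close>
    have "?c y = ?c z \<or> (?c y, ?c z) \<in> joined (hcontract H e) X"
      using step.hyps(2) by (auto simp: joined_def ends_hcontract contract_vertex_eq_iff)
    then show ?case using step.IH by (auto intro: rtrancl_into_rtrancl)
  qed simp
qed

lemma num_components_on_hcontract:
  assumes H: "is_hypergraph H" and e: "e \<in> edges H" and X: "X \<subseteq> edges H - {e}"
  shows "num_components_on (hcontract H e) X = num_components_on H (insert e X)"
proof -
  let ?c = "contract_vertex H e"
  have "card (verts H // joined_eq H (insert e X))
          = card (verts (hcontract H e) // joined_eq (hcontract H e) X)"
  proof (rule card_quotient_pullback[OF equiv_joined_eq equiv_joined_eq])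
    show "?c ` verts H = verts (hcontract H e)" using verts_hcontract[OF H e] by simp
    show "(x, y) \<in> joined_eq H (insert e X) \<longleftrightarrow> (?c x, ?c y) \<in> joined_eq (hcontract H e) X"
      if "x \<in> verts H" "y \<in> verts H" for x y
      using that by (simp add: joined_eq_def joined_rtrancl_hcontract_iff verts_hcontract[OF H e])
  qed
  moreover have "insert e X \<subseteq> edges H" "X \<subseteq> edges (hcontract H e)"
    using e X by (auto simp: edges_hcontract)
  ultimately show ?thesis
    by (simp add: num_components_on_eq[OF H] num_components_on_eq[OF is_hypergraph_hcontract[OF H]])
qed

text \<open>Without hyperedges all classes are singletons, so adding \<open>e\<close> merges one
  class per distinct vertex of \<open>e\<close> into a single class.\<close>

lemma num_components_on_singleton:
  assumes H: "is_hypergraph H" and e: "e \<in> edges H"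
  shows "num_components_on H {e} + card (set_mset (ends H e)) = card (verts H) + 1"
proof -
  have J: "joined_eq H {} = Id_on (verts H)" by (auto simp: joined_eq_def joined_def)
  have card: "card (S // Id_on (verts H)) = card S" if "S \<subseteq> verts H" for S
  proof -
    have "S // Id_on (verts H) = (\<lambda>v. {v}) ` S" using that by (auto simp: quotient_def)
    then show ?thesis by (simp add: card_image)
  qed
  show ?thesis
    using num_components_on_insert[OF H empty_subsetI e] ends_edge(1)[OF H e]
    by (simp add: J card num_components_on_eq[OF H empty_subsetI])
qed

text \<open>Counting components on \<open>A\<close> overwrites the edge set, so the deletion only
  shrinks the domain of the rank function.\<close>

lemma assoc_polymatroid_hdelete:
  "assoc_polymatroid (hdelete H e) = pdelete (assoc_polymatroid H) e"
  by (auto simp: assoc_polymatroid_def pdelete_def hdelete_def num_components_on_def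
      restrict_def fun_eq_iff)

text \<open>Contraction keeps the hyperedge labels, so the isomorphism is an equality.\<close>

lemma assoc_polymatroid_hcontract:
  assumes H: "is_hypergraph H" and e: "e \<in> edges H"
  shows "assoc_polymatroid (hcontract H e) = pcontract (assoc_polymatroid H) e"
proof -
  let ?r = "rank (assoc_polymatroid H)"
  have "int (card (verts (hcontract H e))) - int (num_components_on (hcontract H e) X)
          = ?r (X \<union> {e}) - ?r {e}" if X: "X \<subseteq> edges H - {e}" for X
  proof -
    have "insert e X \<subseteq> edges H" using e X by blast
    \<comment> \<open>The two vertex counts give v(H/e) = \<kappa>({e}), so both sides equal
      \<kappa>({e}) - \<kappa>(X \<union> {e}), with \<kappa> taken in \<open>H\<close>.\<close>
    then show ?thesis
      using num_components_on_hcontract[OF H e X] card_verts_hcontract[OF H e]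
        num_components_on_singleton[OF H e] e
      by (simp add: assoc_polymatroid_def)
  qed
  then show ?thesis
    unfolding assoc_polymatroid_def[of "hcontract H e"] pcontract_def
    by (auto simp: edges_hcontract assoc_polymatroid_def[of H] restrict_def fun_eq_iff)
qed

lemma polymatroid_iso_refl: "P \<cong>\<^sub>P P"
  unfolding polymatroid_iso_def by (rule exI[of _ id]) auto

theorem proposition4p1:
  fixes H :: "('v, 'e) hypergraph" and e :: 'e
  assumes "is_hypergraph H" and "e \<in> edges H"
  shows "assoc_polymatroid (hdelete H e) = pdelete (assoc_polymatroid H) e
         \<and> assoc_polymatroid (hcontract H e) \<cong>\<^sub>P pcontract (assoc_polymatroid H) e"
  using assoc_polymatroid_hdelete assoc_polymatroid_hcontract[OF assms] polymatroid_iso_refl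
  by metis

end
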